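(* Let $k$ be a positive integer and let $r \ge 0$, $s \in (0,1)$ and $p \in (0,1/2]$ be real numbers. Then the random $k$-CNF-XOR formula $\psi^{p}_{k}(n, rn, sn)$ is with high probability $\Omega(n)$-separated; that is, there exists a function $g(n) \in \Omega(n)$ such that $\lim_{n\to\infty} \Pr[\psi^{p}_{k}(n, rn, sn) \text{ is } g(n)\text{-separated}] = 1$.
   Context: Let $X_1, \dots, X_n$ be propositional variables. A $k$-clause is a disjunction of $k$ literals on $k$ distinct variables among $X_1,\dots,X_n$, each variable possibly negated (so there are $\binom{n}{k}2^k$ of them; $n \ge k$ is assumed). An XOR-clause over $n$ variables is the exclusive-or of exactly one of the constants $0$ or $1$ together with a subset of the variables $X_1,\dots,X_n$; if it includes the constant $0$ (respectively $1$), it evaluates to true under a truth assignment if and only if an odd (respectively even) number of its included variables evaluate to true. A random XOR-clause with variable-probability $p \in [0,1]$ is obtained by including each $X_i$ independently with probability $p$, and (independently) including the constant $1$ with probability $1/2$ and the constant $0$ otherwise. $\psi^{p}_{k}(n, rn, sn)$ denotes the random formula that is the conjunction of $\lceil rn\rceil$ $k$-clauses, each chosen uniformly and independently from all $k$-clauses over $n$ variables, and $\lceil sn\rceil$ independently chosen random XOR-clauses over $n$ variables with variable-probability $p$. A solution of a formula is a truth assignment to $X_1,\dots,X_n$ under which the formula evaluates to true. For a real number $d$, a formula is $d$-separated if the Hamming distance between every pair of distinct solutions is at least $d$ (vacuously true if there are fewer than two solutions). $g(n)\in\Omega(n)$ means there is a constant $c>0$ with $g(n)\ge cn$ for all sufficiently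 large $n$. A sequence of events $E_n$ occurs with high probability if $\Pr[E_n]\to 1$ as $n\to\infty$. *)

theory Defs
  imports "HOL-Probability.Probability" "HOL-Probability.Product_PMF"
begin

text \<open>The variables \<open>X\<^sub>1, \<dots>, X\<^sub>n\<close> are the numbers in \<open>{1..n}\<close>. Truth assignments are extensional
  functions, so that two assignments differ as functions iff they differ on some variable.\<close>

definition assignments :: "nat \<Rightarrow> (nat \<Rightarrow> bool) set" where
  "assignments n = {1..n} \<rightarrow>\<^sub>E UNIV"

text \<open>The literal \<open>(i, True)\<close> is \<open>X\<^sub>i\<close>, and \<open>(i, False)\<close> is its negation.\<close>

type_synonym literal = "nat \<times> bool"
type_synonym clause = "literal set"

definition k_clauses :: "nat \<Rightarrow> nat \<Rightarrow> clause set" where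
  "k_clauses k n = {C. C \<subseteq> {1..n} \<times> UNIV \<and> card C = k \<and> inj_on fst C}"

definition sat_clause :: "(nat \<Rightarrow> bool) \<Rightarrow> clause \<Rightarrow> bool" where
  "sat_clause \<sigma> C \<longleftrightarrow> (\<exists>(i, b)\<in>C. \<sigma> i = b)"

text \<open>An XOR-clause: the set of included variables and the constant
  (\<open>True\<close> for 1, \<open>False\<close> for 0).\<close>

type_synonym xor_clause = "nat set \<times> bool"

definition sat_xor :: "(nat \<Rightarrow> bool) \<Rightarrow> xor_clause \<Rightarrow> bool" where
  "sat_xor \<sigma> = (\<lambda>(S, c). if c then even (card {i\<in>S. \<sigma> i}) else odd (card {i\<in>S. \<sigma> i}))"

text \<open>A formula is the conjunction of the clauses in its two lists.\<close>

type_synonym cnf_xor = "clause list \<times> xor_clause list"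

definition solutions :: "nat \<Rightarrow> cnf_xor \<Rightarrow> (nat \<Rightarrow> bool) set" where
  "solutions n = (\<lambda>(Cs, Xs). {\<sigma> \<in> assignments n.
     (\<forall>C\<in>set Cs. sat_clause \<sigma> C) \<and> (\<forall>X\<in>set Xs. sat_xor \<sigma> X)})"

definition hamming :: "nat \<Rightarrow> (nat \<Rightarrow> bool) \<Rightarrow> (nat \<Rightarrow> bool) \<Rightarrow> nat" where
  "hamming n \<sigma> \<tau> = card {i\<in>{1..n}. \<sigma> i \<noteq> \<tau> i}"

definition separated_formula :: "nat \<Rightarrow> real \<Rightarrow> cnf_xor \<Rightarrow> bool" where
  "separated_formula n d F \<longleftrightarrow>
     (\<forall>\<sigma>\<in>solutions n F. \<forall>\<tau>\<in>solutions n F. \<sigma> \<noteq> \<tau> \<longrightarrow> d \<le> real (hamming n \<sigma> \<tau>))"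

definition random_xor_clause :: "nat \<Rightarrow> real \<Rightarrow> xor_clause pmf" where
  "random_xor_clause n p =
     pair_pmf (map_pmf (\<lambda>f. {i\<in>{1..n}. f i}) (Pi_pmf {1..n} False (\<lambda>_. bernoulli_pmf p)))
              (bernoulli_pmf (1/2))"

text \<open>The random formula \<open>\<psi>\<close> with \<open>\<lceil>x\<rceil>\<close> many \<open>k\<close>-clauses and \<open>\<lceil>y\<rceil>\<close> many XOR-clauses.
  It is meaningful only for \<open>n \<ge> k\<close>; otherwise there are no \<open>k\<close>-clauses to choose from and
  \<open>pmf_of_set\<close> is unspecified.\<close>

definition psi :: "real \<Rightarrow> nat \<Rightarrow> nat \<Rightarrow> real \<Rightarrow> real \<Rightarrow> cnf_xor pmf" where
  "psi p k n x y =
     pair_pmf (replicate_pmf (nat \<lceil>x\<rceil>) (pmf_of_set (k_clauses k n)))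
              (replicate_pmf (nat \<lceil>y\<rceil>) (random_xor_clause n p))"

text \<open>The library's \<open>\<Omega>\<close> bounds the norm of \<open>g\<close> and would therefore admit negative functions
  such as \<open>g(n) = -n\<close>, for which separation is vacuous. Here \<open>g\<close> itself is bounded below.\<close>

definition linear_Omega :: "(nat \<Rightarrow> real) set" where
  "linear_Omega = {g. \<exists>c>0. \<forall>\<^sub>F n in sequentially. g n \<ge> c * real n}"

end

theory Submission
  imports Defs
begin

text \<open>The \<open>k\<close>-clauses only remove solutions, so the XOR-clauses alone must separate. If two
  solutions differ exactly on \<open>D\<close>, then every XOR-clause contains an even number of variables of
  \<open>D\<close>. For nonempty \<open>D\<close> a random XOR-clause does so with probability at most \<open>1 - p\<close>: reveal all
  variables but one from \<open>D\<close>, whose inclusion must then take a prescribed value. Hence closeness at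
  distance \<open>c n\<close> has probability at most \<open>(1 - p) ^ \<lceil>s n\<rceil>\<close> times the number of sets
  of size less than \<open>c n\<close>, and for small \<open>c\<close> this tends to 0. The sum runs over differences of
  solutions, not over pairs of solutions, whose expected number may be exponentially large.\<close>

lemma measure_bind_pmf:
  "measure_pmf.prob (bind_pmf M f) A = (\<integral>x. measure_pmf.prob (f x) A \<partial>measure_pmf M)"
proof -
  have "(\<lambda>x. measure_pmf (f x)) \<in> measurable (measure_pmf M) (subprob_algebra (count_space UNIV))"
    using measurable_measure_pmf[of f] by simp
  from measure_pmf.measure_bind[OF this] show ?thesis
    by (simp add: measure_pmf_bind)
qed

lemma prob_replicate_pmf_all:
  "measure_pmf.prob (replicate_pmf m M) {xs. \<forall>x\<in>set xs. P x} = measure_pmf.prob M {x. P x} ^ m"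
proof (induction m)
  case 0
  show ?case by (simp add: measure_return)
next
  case (Suc m)
  have tail: "measure_pmf.prob (bind_pmf (replicate_pmf m M) (\<lambda>xs. return_pmf (x # xs)))
      {xs. \<forall>x\<in>set xs. P x} = indicator {x. P x} x * measure_pmf.prob M {x. P x} ^ m" for x
    using Suc by (simp add: map_pmf_def[symmetric] vimage_def indicator_def)
  show ?case
    by (simp add: measure_bind_pmf[of M] tail)
qed

lemma prob_even_card_le:
  assumes "finite A" "D \<subseteq> A" "D \<noteq> {}" and p: "0 \<le> p" "p \<le> 1/2"
  shows "measure_pmf.prob (Pi_pmf A False (\<lambda>_. bernoulli_pmf p))
    {f. even (card {i\<in>D. f i})} \<le> 1 - p"
proof -
  obtain i where i: "i \<in> D" using assms by blast
  define B where "B = A - {i}"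
  have A: "A = insert i B" "i \<notin> B" "finite B" using i assms by (auto simp: B_def)
  have fin: "finite {j\<in>D - {i}. f j}" for f :: "_ \<Rightarrow> bool"
    using assms by (auto intro: finite_subset)
  \<comment> \<open>Once the variables other than \<open>i\<close> are revealed, \<open>E\<close>
    forces \<open>i\<close> to be left out and its complement forces \<open>i\<close> to be
    included.\<close>
  define E where "E = {f. even (card {j\<in>D - {i}. f j})}"
  let ?M = "Pi_pmf B False (\<lambda>_. bernoulli_pmf p)"
  have split: "{j\<in>D. (f(i := y)) j} =
      (if y then insert i {j\<in>D - {i}. f j} else {j\<in>D - {i}. f j})" for f y
    using i by auto
  have inner: "measure_pmf.prob (bind_pmf ?M (\<lambda>f. return_pmf (f(i := y))))
      {f. even (card {j\<in>D. f j})} = (if y then 1 - measure_pmf.prob ?M E else measure_pmf.prob ?M E)" for y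
  proof -
    have "measure_pmf.prob ?M (- E) = 1 - measure_pmf.prob ?M E"
      using measure_pmf.prob_compl[of E ?M] by (simp add: Compl_eq_Diff_UNIV)
    moreover have "even (card {j\<in>D. (f(i := y)) j}) \<longleftrightarrow> (y \<longleftrightarrow> f \<notin> E)" for f
      by (subst split) (use fin[of f] in \<open>auto simp: E_def\<close>)
    then have "(\<lambda>f. f(i := y)) -` {f. even (card {j\<in>D. f j})} = (if y then - E else E)"
      by (simp only: vimage_def mem_Collect_eq) auto
    ultimately show ?thesis
      by (simp add: map_pmf_def[symmetric])
  qed
  have "measure_pmf.prob (Pi_pmf A False (\<lambda>_. bernoulli_pmf p)) {f. even (card {i\<in>D. f i})}
      = p * (1 - measure_pmf.prob ?M E) + (1 - p) * measure_pmf.prob ?M E"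
    using p by (simp add: A Pi_pmf_insert' measure_bind_pmf[of "bernoulli_pmf p"] inner)
  \<comment> \<open>Of the two values that may be prescribed for \<open>i\<close>, omission is the
    likelier one: \<open>p \<le> 1 - p\<close> because \<open>p \<le> 1/2\<close>.\<close>
  also have "\<dots> \<le> (1 - p) * (1 - measure_pmf.prob ?M E) + (1 - p) * measure_pmf.prob ?M E"
    using p by (intro add_right_mono mult_right_mono) auto
  finally show ?thesis by (simp add: algebra_simps)
qed

lemma prob_xor_even_le:
  assumes "D \<subseteq> {1..n}" "D \<noteq> {}" "0 \<le> p" "p \<le> 1/2"
  shows "measure_pmf.prob (random_xor_clause n p) {X. even (card (fst X \<inter> D))} \<le> 1 - p"
proof -
  have D: "{i\<in>{1..n}. f i} \<inter> D = {i\<in>D. f i}" for f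
    using assms(1) by auto
  have "measure_pmf.prob (random_xor_clause n p) {X. even (card (fst X \<inter> D))}
      = measure_pmf.prob (map_pmf fst (random_xor_clause n p)) {S. even (card (S \<inter> D))}"
    by (simp add: vimage_def)
  also have "\<dots> = measure_pmf.prob (Pi_pmf {1..n} False (\<lambda>_. bernoulli_pmf p))
      {f. even (card ({i\<in>{1..n}. f i} \<inter> D))}"
    by (simp add: random_xor_clause_def map_fst_pair_pmf vimage_def)
  also have "\<dots> = measure_pmf.prob (Pi_pmf {1..n} False (\<lambda>_. bernoulli_pmf p))
      {f. even (card {i\<in>D. f i})}"
    by (simp only: D)
  finally show ?thesis
    using prob_even_card_le[of "{1..n}" D p] assms by simp
qed

text \<open>Adding the two satisfied parity equations modulo 2 cancels the constant and every
  variable on which the assignments agree.\<close>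

lemma even_card_differ_of_sat_xor:
  assumes "finite (fst X)" "sat_xor \<sigma> X" "sat_xor \<tau> X"
  shows "even (card {i\<in>fst X. \<sigma> i \<noteq> \<tau> i})"
proof -
  obtain S c where X: "X = (S, c)" by (cases X)
  have S: "finite S" using assms X by simp
  define a b d where "a = card {i\<in>S. \<sigma> i \<and> \<not> \<tau> i}" "b = card {i\<in>S. \<not> \<sigma> i \<and> \<tau> i}"
    "d = card {i\<in>S. \<sigma> i \<and> \<tau> i}"
  have "card {i\<in>S. \<sigma> i} = a + d" "card {i\<in>S. \<tau> i} = b + d"
    "card {i\<in>S. \<sigma> i \<noteq> \<tau> i} = a + b"
    unfolding a_b_d_def using S
    by (subst card_Un_disjoint[symmetric]; force intro: arg_cong[where f = card])+
  then show ?thesis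
    using assms(2,3) unfolding X sat_xor_def by (auto split: if_splits)
qed

lemma sum_power_card_Pow:
  fixes x :: "'a::comm_semiring_1"
  assumes "finite A"
  shows "(\<Sum>D\<in>Pow A. x ^ card D) = (x + 1) ^ card A"
  using prod_add[OF assms, of "\<lambda>_. x" "\<lambda>_. 1"] by simp

text \<open>A Chernoff-type bound in place of estimates for binomial sums: give \<open>D\<close> the
  weight \<open>x ^ card D\<close>. Each counted set weighs at least \<open>x powr d\<close>, since
  \<open>x < 1\<close>, and all subsets together weigh \<open>(x + 1) ^ card A\<close>. The
  parameter \<open>x\<close> stays free for later tuning.\<close>

lemma card_small_subsets_le:
  fixes x d :: real
  assumes "finite A" "0 < x" "x < 1"
  shows "real (card {D\<in>Pow A. real (card D) < d}) \<le> (x + 1) ^ card A / x powr d"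
proof -
  let ?F = "{D\<in>Pow A. real (card D) < d}"
  have "x powr d * real (card ?F) = (\<Sum>D\<in>?F. x powr d)" by simp
  also have "\<dots> \<le> (\<Sum>D\<in>?F. x ^ card D)"
    using assms by (intro sum_mono) (simp add: powr_realpow[symmetric] powr_mono')
  also have "\<dots> \<le> (\<Sum>D\<in>Pow A. x ^ card D)"
    using assms by (intro sum_mono2) auto
  finally show ?thesis
    using assms by (simp add: sum_power_card_Pow field_simps)
qed

text \<open>A union bound over the possible difference sets \<open>D\<close>; for each one,
  independence of the XOR-clauses turns the bound for a single clause into a power.\<close>

lemma prob_not_separated_le:
  fixes x y d p :: real
  assumes p: "0 \<le> p" "p \<le> 1/2"
  shows "measure_pmf.prob (psi p k n x y) {F. \<not> separated_formula n d F}
    \<le> real (card {D\<in>Pow {1..n}. real (card D) < d}) * (1 - p) ^ nat \<lceil>y\<rceil>"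
proof -
  \<comment> \<open>The empty set is removed because its event \<open>E {}\<close> is
    certain.\<close>
  define \<D> where "\<D> = {D\<in>Pow {1..n}. real (card D) < d} - {{}}"
  define E where "E D = {F :: cnf_xor. \<forall>X\<in>set (snd F). even (card (fst X \<inter> D))}" for D
  let ?M = "psi p k n x y"
  have fin: "finite {D\<in>Pow {1..n}. real (card D) < d}" by simp
  have supp: "fst X \<subseteq> {1..n}" if "F \<in> set_pmf ?M" "X \<in> set (snd F)" for F X
  proof -
    have "X \<in> set_pmf (random_xor_clause n p)"
      using that by (auto simp: psi_def set_replicate_pmf)
    then show ?thesis by (auto simp: random_xor_clause_def)
  qed
  have E: "F \<in> (\<Union>D\<in>\<D>. E D)" if F: "F \<in> set_pmf ?M" and close: "\<not> separated_formula n d F" for F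
  proof -
    obtain \<sigma> \<tau> where st: "\<sigma> \<in> solutions n F" "\<tau> \<in> solutions n F" "\<sigma> \<noteq> \<tau>"
      "real (hamming n \<sigma> \<tau>) < d"
      using close by (auto simp: separated_formula_def not_le)
    define D where "D = {i\<in>{1..n}. \<sigma> i \<noteq> \<tau> i}"
    have "\<sigma> \<in> assignments n" "\<tau> \<in> assignments n"
      using st by (auto simp: solutions_def split: prod.splits)
    \<comment> \<open>Assignments are extensional, so distinct ones differ somewhere inside
      \<open>{1..n}\<close>.\<close>
    then have "D \<noteq> {}"
      using st(3) PiE_ext[of \<sigma> "{1..n}" "\<lambda>_. UNIV" \<tau>] unfolding D_def assignments_def by blast
    then have "D \<in> \<D>"
      using st(4) by (auto simp: \<D>_def D_def hamming_def)
    moreover have "even (card (fst X \<inter> D))" if X: "X \<in> set (snd F)" for X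
    proof -
      have "sat_xor \<sigma> X" "sat_xor \<tau> X"
        using st X by (auto simp: solutions_def split: prod.splits)
      moreover have "fst X \<inter> D = {i\<in>fst X. \<sigma> i \<noteq> \<tau> i}"
        using supp[OF F X] by (auto simp: D_def)
      ultimately show ?thesis
        using even_card_differ_of_sat_xor[of X \<sigma> \<tau>] supp[OF F X]
        by (simp add: finite_subset[of _ "{1..n}"])
    qed
    ultimately show ?thesis unfolding E_def by blast
  qed
  have prob_E: "measure_pmf.prob ?M (E D) \<le> (1 - p) ^ nat \<lceil>y\<rceil>" if "D \<in> \<D>" for D
  proof -
    have "measure_pmf.prob ?M (E D) = measure_pmf.prob (map_pmf snd ?M)
        {Xs. \<forall>X\<in>set Xs. even (card (fst X \<inter> D))}"
      by (simp add: E_def vimage_def)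
    also have "\<dots> = measure_pmf.prob (random_xor_clause n p) {X. even (card (fst X \<inter> D))} ^ nat \<lceil>y\<rceil>"
      by (simp add: psi_def map_snd_pair_pmf prob_replicate_pmf_all)
    also have "\<dots> \<le> (1 - p) ^ nat \<lceil>y\<rceil>"
      using that p by (intro power_mono prob_xor_even_le) (auto simp: \<D>_def)
    finally show ?thesis .
  qed
  \<comment> \<open>The inclusion of events is known only on the support, where XOR-clauses use
    variables from \<open>{1..n}\<close>; hence almost-sure monotonicity.\<close>
  have "measure_pmf.prob ?M {F. \<not> separated_formula n d F} \<le> measure_pmf.prob ?M (\<Union>D\<in>\<D>. E D)"
    using E by (intro measure_pmf.finite_measure_mono_AE) (auto simp: AE_measure_pmf_iff)
  also have "\<dots> \<le> (\<Sum>D\<in>\<D>. measure_pmf.prob ?M (E D))"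
    using fin by (intro measure_pmf.finite_measure_subadditive_finite) (auto simp: \<D>_def)
  also have "\<dots> \<le> real (card \<D>) * (1 - p) ^ nat \<lceil>y\<rceil>"
    using sum_mono[of \<D> "\<lambda>D. measure_pmf.prob ?M (E D)" "\<lambda>_. (1 - p) ^ nat \<lceil>y\<rceil>"] prob_E by simp
  also have "\<dots> \<le> real (card {D\<in>Pow {1..n}. real (card D) < d}) * (1 - p) ^ nat \<lceil>y\<rceil>"
    using p fin by (intro mult_right_mono) (auto simp: \<D>_def intro!: card_mono)
  finally show ?thesis .
qed

theorem mainTheorem3:
  fixes k :: nat and r s p :: real
  assumes "k > 0" and "r \<ge> 0" and "s \<in> {0<..<1}" and "p \<in> {0<..1/2}"
  shows "\<exists>g\<in>linear_Omega.
    (\<lambda>n. measure_pmf.prob (psi p k n (r * real n) (s * real n)) {F. separated_formula n (g n) F})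
      \<longlonglongrightarrow> 1"
proof -
  have s: "0 < s" and p: "0 < p" "p \<le> 1/2" using assms by auto
  \<comment> \<open>The decay rate per variable: the parity bound for all XOR-clauses together is at
    most \<open>q ^ n\<close>.\<close>
  define q where "q = (1 - p) powr s"
  have q: "0 < q" "q < 1"
    using s p powr_less_mono2[of s "1 - p" 1] by (auto simp: q_def)
  \<comment> \<open>Any \<open>x\<close> with \<open>(x + 1) * q < 1\<close> leaves room for a
    positive \<open>c\<close>; \<open>x = 1 - q\<close> gives the closed form
    \<open>1 - x^2\<close>.\<close>
  define x y where "x = 1 - q" and "y = (x + 1) * q"
  have x: "0 < x" "x < 1" using q by (auto simp: x_def)
  have "y = 1 - x\<^sup>2" by (simp add: x_def y_def power2_eq_square algebra_simps)
  then have y: "y < 1" using x by simp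
  have "0 < y" using x q by (simp add: y_def)
  note y = this y
  \<comment> \<open>chosen so that \<open>(x + 1) * q / x powr c\<close>, the base of the geometric bound, is \<open>sqrt y\<close>\<close>
  define c where "c = ln y / (2 * ln x)"
  have c: "c > 0" using x y by (simp add: c_def divide_neg_neg)
  have xc: "x powr c = sqrt y"
    using x y by (simp add: c_def powr_def powr_half_sqrt[symmetric])
  define P where "P n = measure_pmf.prob (psi p k n (r * real n) (s * real n))
    {F. separated_formula n (c * real n) F}" for n
  have P_ge: "P n \<ge> 1 - sqrt y ^ n" for n
  proof -
    let ?M = "psi p k n (r * real n) (s * real n)"
    have "(1 - p) ^ nat \<lceil>s * real n\<rceil> = (1 - p) powr real (nat \<lceil>s * real n\<rceil>)"
      using p by (simp add: powr_realpow)
    \<comment> \<open>Rounding the exponent up only lowers the power, since the base is below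
      1.\<close>
    also have "\<dots> \<le> (1 - p) powr (s * real n)"
      using p by (intro powr_mono'[OF real_nat_ceiling_ge]) auto
    also have "\<dots> = q ^ n"
      using p q by (simp add: q_def powr_powr[symmetric] powr_realpow)
    finally have q_n: "(1 - p) ^ nat \<lceil>s * real n\<rceil> \<le> q ^ n" .
    have "1 - P n = measure_pmf.prob ?M {F. \<not> separated_formula n (c * real n) F}"
      unfolding P_def using measure_pmf.prob_compl[of "{F. separated_formula n (c * real n) F}" ?M]
      by (simp add: Compl_eq_Diff_UNIV[symmetric] Collect_neg_eq)
    also have "\<dots> \<le> real (card {D\<in>Pow {1..n}. real (card D) < c * real n})
        * (1 - p) ^ nat \<lceil>s * real n\<rceil>"
      using p by (intro prob_not_separated_le) auto
    also have "\<dots> \<le> ((x + 1) ^ n / x powr (c * real n)) * q ^ n"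
      using card_small_subsets_le[of "{1..n}" x "c * real n"] x p q q_n
      by (intro mult_mono) auto
    also have "x powr (c * real n) = sqrt y ^ n"
      using x y by (simp add: powr_powr[symmetric] xc powr_realpow)
    also have "(x + 1) ^ n / sqrt y ^ n * q ^ n = (y / sqrt y) ^ n"
      by (simp add: y_def power_mult_distrib power_divide)
    also have "y / sqrt y = sqrt y"
      using y by (simp add: real_div_sqrt)
    finally show ?thesis by simp
  qed
  have lower: "(\<lambda>n. 1 - sqrt y ^ n) \<longlonglongrightarrow> 1"
    using tendsto_diff[OF tendsto_const LIMSEQ_power_zero[of "sqrt y"], of 1] y by simp
  have "P \<longlonglongrightarrow> 1"
  proof (rule tendsto_sandwich[OF _ _ lower tendsto_const])
    show "\<forall>\<^sub>F n in sequentially. 1 - sqrt y ^ n \<le> P n" by (simp add: P_ge)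
    show "\<forall>\<^sub>F n in sequentially. P n \<le> 1" by (simp add: P_def)
  qed
  moreover have "(\<lambda>n. c * real n) \<in> linear_Omega"
    using c by (auto simp: linear_Omega_def)
  ultimately show ?thesis
    unfolding P_def by (intro bexI[of _ "\<lambda>n. c * real n"])
qed

end
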